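(* There exists a $C^\infty$ function $\gamma:S^2\to\mathbb{R}_{>0}$ which is not a convex integrand such that there exist closed embedded CAMC surfaces in $\mathbb{R}^3$ for $\gamma$, each of genus zero (i.e. $X:M\to\mathbb{R}^3$ with $M$ homeomorphic to $S^2$), none of which is a homothety or a translation of the Wulff shape $W_\gamma$ (i.e. $X(M)\ne aW_\gamma+b$ for all $a>0$, $b\in\mathbb{R}^3$).
   Context: $S^n=\{\nu\in\mathbb{R}^{n+1}:\|\nu\|=1\}$. For a positive continuous $\gamma:S^n\to\mathbb{R}_{>0}$, its homogeneous extension is $\overline{\gamma}(rX)=r\gamma(X)$ for $X\in S^n$, $r\ge 0$; $\gamma$ is called a convex integrand if $\overline{\gamma}$ is a convex function on $\mathbb{R}^{n+1}$. The Wulff shape $W_\gamma$ is the boundary of $\bigcap_{\nu\in S^n}\{X:\langle X,\nu\rangle\le\gamma(\nu)\}$. For $C^2$ $\gamma$, the Cahn–Hoffman map is $\xi_\gamma(\nu)=D\gamma|_\nu+\gamma(\nu)\nu$ ($D\gamma$ the gradient on $S^n$). Piecewise-$C^r$ weak immersion: $M=\bigcup_{i=1}^k M_i$ is an $n$-dimensional oriented compact connected $C^\infty$ manifold, each $M_i$ a connected compact $n$-dimensional submanifold with boundary, $M_i\cap M_j=\partial M_i\cap\partial M_j$ for $i\ne j$; $X:M\to\mathbb{R}^{n+1}$ is continuous, each $X|_{M_i}$ is $C^r$, $X|_{M_i^\circ}$ is a $C^r$ immersion, and the (oriented) unit normal $\nu_i$ of $X|_{M_i^\circ}$ extends to a $C^{r-1}$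 map $\nu_i:M_i\to S^n$. $S(X)$ is the set of points where $X$ is not an immersion. Cahn–Hoffman field $\tilde\xi_i=\xi_\gamma\circ\nu_i$; anisotropic shape operator $S^\gamma=-d\tilde\xi_i$; anisotropic mean curvature $\Lambda=\frac1n\operatorname{trace}S^\gamma$ at regular points. $X$ is CAMC for $\gamma$ if $\Lambda$ is constant on $M\setminus S(X)$ and $\tilde\xi_i(\zeta)-\tilde\xi_j(\zeta)\in T_\zeta(\partial M_i\cap\partial M_j)$ for all $\zeta\in\partial M_i\cap\partial M_j$. Closed embedded means $M$ is closed and $X$ is injective. *)

theory Defs
  imports "HOL-Analysis.Analysis" "HOL-Analysis.Cross3"
begin

primrec Ck_on :: "nat \<Rightarrow> ('a::euclidean_space) set \<Rightarrow> ('a \<Rightarrow> real) \<Rightarrow> bool" where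
  "Ck_on 0 U f = continuous_on U f"
| "Ck_on (Suc k) U f =
     (\<forall>i\<in>Basis. \<exists>g. (\<forall>x\<in>U. ((\<lambda>t. f (x + t *\<^sub>R i)) has_real_derivative g x) (at 0))
                       \<and> Ck_on k U g)"

definition Ck_vec :: "nat \<Rightarrow> ('a::euclidean_space) set \<Rightarrow> ('a \<Rightarrow> 'b::euclidean_space) \<Rightarrow> bool" where
  "Ck_vec k U f = (\<forall>b\<in>Basis. Ck_on k U (\<lambda>x. f x \<bullet> b))"

definition Cinf_vec :: "('a::euclidean_space) set \<Rightarrow> ('a \<Rightarrow> 'b::euclidean_space) \<Rightarrow> bool" where
  "Cinf_vec U f = (\<forall>k. Ck_vec k U f)"

definition Ck_set :: "nat \<Rightarrow> ('a::euclidean_space) set \<Rightarrow> ('a \<Rightarrow> 'b::euclidean_space) \<Rightarrow> bool" where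
  "Ck_set k A f = (\<exists>U F. open U \<and> A \<subseteq> U \<and> Ck_vec k U F \<and> (\<forall>x\<in>A. F x = f x))"

definition Cinf_set :: "('a::euclidean_space) set \<Rightarrow> ('a \<Rightarrow> 'b::euclidean_space) \<Rightarrow> bool" where
  "Cinf_set A f = (\<exists>U F. open U \<and> A \<subseteq> U \<and> Cinf_vec U F \<and> (\<forall>x\<in>A. F x = f x))"

definition S2 :: "(real^3) set" where
  "S2 = sphere 0 1"

definition tang :: "real^3 \<Rightarrow> (real^3) set" where
  "tang p = {v. v \<bullet> p = 0}"

definition scurve :: "real^3 \<Rightarrow> real^3 \<Rightarrow> real \<Rightarrow> real^3" where
  "scurve p v t = (1 / norm (p + t *\<^sub>R v)) *\<^sub>R (p + t *\<^sub>R v)"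

definition sdiff :: "(real^3 \<Rightarrow> 'b::real_normed_vector) \<Rightarrow> real^3 \<Rightarrow> real^3 \<Rightarrow> 'b" where
  "sdiff f p v = vector_derivative (\<lambda>t. f (scurve p v t)) (at 0)"

definition sdiffable :: "(real^3 \<Rightarrow> 'b::real_normed_vector) \<Rightarrow> real^3 \<Rightarrow> bool" where
  "sdiffable f p = (\<forall>v\<in>tang p. (\<lambda>t. f (scurve p v t)) differentiable (at 0))"

definition sgrad :: "(real^3 \<Rightarrow> real) \<Rightarrow> real^3 \<Rightarrow> real^3" where
  "sgrad g \<nu> = (THE v. v \<in> tang \<nu> \<and>
      (\<forall>w\<in>tang \<nu>. norm w = 1 \<longrightarrow>
         ((\<lambda>t. g (cos t *\<^sub>R \<nu> + sin t *\<^sub>R w)) has_real_derivative (v \<bullet> w)) (at 0)))"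

definition cahn_hoffman :: "(real^3 \<Rightarrow> real) \<Rightarrow> real^3 \<Rightarrow> real^3" where
  "cahn_hoffman g \<nu> = sgrad g \<nu> + g \<nu> *\<^sub>R \<nu>"

definition homext :: "(real^3 \<Rightarrow> real) \<Rightarrow> real^3 \<Rightarrow> real" where
  "homext g x = norm x * g (x /\<^sub>R norm x)"

definition convex_integrand :: "(real^3 \<Rightarrow> real) \<Rightarrow> bool" where
  "convex_integrand g = convex_on UNIV (homext g)"

definition Wulff :: "(real^3 \<Rightarrow> real) \<Rightarrow> (real^3) set" where
  "Wulff g = frontier (\<Inter>\<nu>\<in>S2. {x. x \<bullet> \<nu> \<le> g \<nu>})"

definition bdS :: "(real^3) set \<Rightarrow> (real^3) set" where
  "bdS A = A \<inter> closure (S2 - A)"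

definition intS :: "(real^3) set \<Rightarrow> (real^3) set" where
  "intS A = A - bdS A"

text \<open>A connected compact 2-dimensional smooth submanifold with boundary of S^2:
every point has a smooth chart of S^2 sending the piece onto a relatively open part of the
closed half-plane.\<close>
definition regular_domain :: "(real^3) set \<Rightarrow> bool" where
  "regular_domain A \<longleftrightarrow> A \<subseteq> S2 \<and> compact A \<and> connected A \<and>
     (\<forall>p\<in>A. \<exists>W \<Omega> (\<psi>::real^2 \<Rightarrow> real^3). open W \<and> p \<in> W \<and> open \<Omega> \<and>
        Cinf_vec \<Omega> \<psi> \<and> inj_on \<psi> \<Omega> \<and> \<psi> ` \<Omega> = S2 \<inter> W \<and>
        (\<exists>\<phi>::real^3 \<Rightarrow> real^2. Cinf_set (S2 \<inter> W) \<phi> \<and> (\<forall>y\<in>\<Omega>. \<phi> (\<psi> y) = y)) \<and>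
        \<psi> ` (\<Omega> \<inter> {y. y $ 2 \<ge> 0}) = A \<inter> W)"

text \<open>Pieces M 0, ..., M (k-1); X : S^2 -> R^3; nu i : M i -> S^2 the extended normal of piece i.
M = S^2 carries its standard (outward) orientation.\<close>
definition pw_weak_immersion ::
  "nat \<Rightarrow> (nat \<Rightarrow> (real^3) set) \<Rightarrow> (real^3 \<Rightarrow> real^3) \<Rightarrow> (nat \<Rightarrow> real^3 \<Rightarrow> real^3) \<Rightarrow> bool" where
  "pw_weak_immersion k M X \<nu> \<longleftrightarrow> k \<ge> 1 \<and> continuous_on S2 X \<and>
     (\<Union>i<k. M i) = S2 \<and>
     (\<forall>i<k. regular_domain (M i)) \<and>
     (\<forall>i<k. \<forall>j<k. i \<noteq> j \<longrightarrow> M i \<inter> M j = bdS (M i) \<inter> bdS (M j)) \<and>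
     (\<forall>i<k. Ck_set 2 (M i) X) \<and>
     (\<forall>i<k. \<forall>p\<in>intS (M i). \<forall>v\<in>tang p. v \<noteq> 0 \<longrightarrow> sdiff X p v \<noteq> 0) \<and>
     (\<forall>i<k. Ck_set 1 (M i) (\<nu> i) \<and> \<nu> i ` M i \<subseteq> S2 \<and>
        (\<forall>p\<in>intS (M i).
           (\<forall>v\<in>tang p. \<nu> i p \<bullet> sdiff X p v = 0) \<and>
           (\<forall>v\<in>tang p. \<forall>w\<in>tang p. cross3 v w \<bullet> p > 0 \<longrightarrow>
               cross3 (sdiff X p v) (sdiff X p w) \<bullet> \<nu> i p > 0)))"

text \<open>Anisotropic mean curvature (1/2) trace S^gamma, where dX(S^gamma v) = - d xi(v),
computed in an arbitrary basis e1, e2 of the tangent plane.\<close>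
definition anis_mc ::
  "(real^3 \<Rightarrow> real) \<Rightarrow> (real^3 \<Rightarrow> real^3) \<Rightarrow> (real^3 \<Rightarrow> real^3) \<Rightarrow> real^3 \<Rightarrow> real^3 \<Rightarrow> real^3 \<Rightarrow> real" where
  "anis_mc g X n p e1 e2 =
     (let a1 = sdiff X p e1; a2 = sdiff X p e2;
          b1 = sdiff (\<lambda>q. cahn_hoffman g (n q)) p e1;
          b2 = sdiff (\<lambda>q. cahn_hoffman g (n q)) p e2;
          N = cross3 a1 a2
      in - ((cross3 b1 a2 + cross3 a1 b2) \<bullet> N) / (2 * (norm N)\<^sup>2))"

definition tspace :: "(real^3) set \<Rightarrow> real^3 \<Rightarrow> (real^3) set" where
  "tspace A q = span {v. \<exists>a::nat \<Rightarrow> real^3. (\<forall>n. a n \<in> A \<and> a n \<noteq> q) \<and> a \<longlonglongrightarrow> q \<and>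
                      (\<lambda>n. (a n - q) /\<^sub>R norm (a n - q)) \<longlonglongrightarrow> v}"

definition CAMC ::
  "(real^3 \<Rightarrow> real) \<Rightarrow> nat \<Rightarrow> (nat \<Rightarrow> (real^3) set) \<Rightarrow> (real^3 \<Rightarrow> real^3) \<Rightarrow> (nat \<Rightarrow> real^3 \<Rightarrow> real^3) \<Rightarrow> bool" where
  "CAMC g k M X \<nu> \<longleftrightarrow> pw_weak_immersion k M X \<nu> \<and>
     (\<exists>\<Lambda>. \<forall>i<k. \<forall>p\<in>intS (M i). sdiffable (\<lambda>q. cahn_hoffman g (\<nu> i q)) p \<and>
         (\<forall>e1\<in>tang p. \<forall>e2\<in>tang p. cross3 e1 e2 \<noteq> 0 \<longrightarrow> anis_mc g X (\<nu> i) p e1 e2 = \<Lambda>)) \<and>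
     (\<forall>i<k. \<forall>j<k. i \<noteq> j \<longrightarrow> (\<forall>\<zeta>\<in>bdS (M i) \<inter> bdS (M j).
         cahn_hoffman g (\<nu> i \<zeta>) - cahn_hoffman g (\<nu> j \<zeta>)
           \<in> tspace (X ` (bdS (M i) \<inter> bdS (M j))) (X \<zeta>)))"

end

(* The integrand depends only on the height z of the normal, g = 70 - 27 z^2 - 25 z^4.  Its
   Cahn--Hoffman map has height z (25 z^2 - 16) (3 z^2 - 1), so the caps |z| >= 4/5 of the normal
   sphere are mapped to two graphs that meet along a circle of radius 354/5 in the plane of
   height 0.  On each cap the map is an orientation preserving immersion with normal nu, so the
   closed surface X formed by the two caps satisfies xi(nu) = X; hence the anisotropic mean
   curvature is -1 and xi does not jump along the edge.
   At the equator g equals 70 < 354/5, so the Wulff shape is too thin to be homothetic to X: it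
   contains the points of height 18 and -18 on the axis and lies in |x_1| <= 70, whereas X has
   height at most 18 in absolute value and contains points with x_1 = 354/5 and x_1 = -354/5.
   The same dip destroys convexity. *)
theory Submission
  imports Defs
begin

section \<open>Smoothness of rational functions\<close>

text \<open>A syntactic class that is closed under partial differentiation, which is what the
  recursion in \<open>Ck_on\<close> asks for: every derivative found is again in the class. The only
  analytic condition, a denominator without zeros on \<open>U\<close>, sits in the rule for
  inverses.\<close>

inductive ratfun :: "('a::euclidean_space) set \<Rightarrow> ('a \<Rightarrow> real) \<Rightarrow> bool" for U where
  ratfun_const: "ratfun U (\<lambda>x. c)"
| ratfun_inner: "ratfun U (\<lambda>x. x \<bullet> b)"
| ratfun_add: "ratfun U f \<Longrightarrow> ratfun U g \<Longrightarrow> ratfun U (\<lambda>x. f x + g x)"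
| ratfun_mult: "ratfun U f \<Longrightarrow> ratfun U g \<Longrightarrow> ratfun U (\<lambda>x. f x * g x)"
| ratfun_inverse: "ratfun U f \<Longrightarrow> (\<And>x. x \<in> U \<Longrightarrow> f x \<noteq> 0) \<Longrightarrow> ratfun U (\<lambda>x. inverse (f x))"

lemma ratfun_continuous_on: "ratfun U f \<Longrightarrow> continuous_on U f"
  by (induction rule: ratfun.induct) (auto intro!: continuous_intros)

lemma ratfun_partial:
  assumes "ratfun U f"
  shows "\<exists>g. (\<forall>x\<in>U. ((\<lambda>t. f (x + t *\<^sub>R i)) has_real_derivative g x) (at 0)) \<and> ratfun U g"
  using assms
proof (induction rule: ratfun.induct)
  case (ratfun_const c)
  show ?case by (rule exI[of _ "\<lambda>x. 0"]) (auto intro: ratfun.intros)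
next
  case (ratfun_inner b)
  show ?case
    by (rule exI[of _ "\<lambda>x. i \<bullet> b"])
      (auto intro!: ratfun.intros derivative_eq_intros simp: inner_add_left)
next
  case (ratfun_add f g)
  then obtain f' g' where
    "\<forall>x\<in>U. ((\<lambda>t. f (x + t *\<^sub>R i)) has_real_derivative f' x) (at 0)" "ratfun U f'"
    "\<forall>x\<in>U. ((\<lambda>t. g (x + t *\<^sub>R i)) has_real_derivative g' x) (at 0)" "ratfun U g'"
    by blast
  then show ?case
    by (intro exI[of _ "\<lambda>x. f' x + g' x"]) (auto intro!: ratfun.intros derivative_intros)
next
  case (ratfun_mult f g)
  then obtain f' g' where
    "\<forall>x\<in>U. ((\<lambda>t. f (x + t *\<^sub>R i)) has_real_derivative f' x) (at 0)" "ratfun U f'"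
    "\<forall>x\<in>U. ((\<lambda>t. g (x + t *\<^sub>R i)) has_real_derivative g' x) (at 0)" "ratfun U g'"
    by blast
  with ratfun_mult.hyps show ?case
    by (intro exI[of _ "\<lambda>x. f' x * g x + g' x * f x"])
      (auto intro!: ratfun.intros derivative_eq_intros)
next
  case (ratfun_inverse f)
  then obtain f' where f':
    "\<forall>x\<in>U. ((\<lambda>t. f (x + t *\<^sub>R i)) has_real_derivative f' x) (at 0)" "ratfun U f'"
    by blast
  have "((\<lambda>t. inverse (f (x + t *\<^sub>R i))) has_real_derivative
          (-1) * (inverse (f x) * f' x * inverse (f x))) (at 0)" if "x \<in> U" for x
    using DERIV_inverse'[OF f'(1)[rule_format, OF that]] ratfun_inverse.hyps(2)[OF that] by simp
  moreover have "ratfun U (\<lambda>x. (-1) * (inverse (f x) * f' x * inverse (f x)))"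
    by (intro ratfun.intros f' ratfun_inverse.hyps)
  ultimately show ?case
    by (intro exI[of _ "\<lambda>x. (-1) * (inverse (f x) * f' x * inverse (f x))"] conjI ballI)
qed

lemma ratfun_Ck_on: "ratfun U f \<Longrightarrow> Ck_on k U f"
proof (induction k arbitrary: f)
  case 0
  then show ?case by (simp add: ratfun_continuous_on)
next
  case (Suc k)
  then show ?case using ratfun_partial[of U f] by (simp, blast)
qed

lemma ratfun_diff: "ratfun U f \<Longrightarrow> ratfun U g \<Longrightarrow> ratfun U (\<lambda>x. f x - g x)"
  using ratfun_add[of U f "\<lambda>x. (-1) * g x"] ratfun_mult[OF ratfun_const[of U "-1"], of g] by simp

lemma ratfun_divide:
  "ratfun U f \<Longrightarrow> ratfun U g \<Longrightarrow> (\<And>x. x \<in> U \<Longrightarrow> g x \<noteq> 0) \<Longrightarrow> ratfun U (\<lambda>x. f x / g x)"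
  unfolding divide_inverse by (intro ratfun.intros)

lemma ratfun_power: "ratfun U f \<Longrightarrow> ratfun U (\<lambda>x. f x ^ n)"
  by (induction n) (auto intro: ratfun.intros)

lemma ratfun_nth: "ratfun U (\<lambda>x::real^'n. x $ i)"
  using ratfun_inner[of U "axis i 1"] by (simp add: inner_axis)

lemmas ratfun_intros =
  ratfun_nth ratfun_const ratfun_add ratfun_diff ratfun_mult ratfun_power ratfun_divide

lemma ratfun_Ck_vec:
  fixes f :: "'a::euclidean_space \<Rightarrow> real^'n"
  assumes "\<And>i. ratfun U (\<lambda>x. f x $ i)"
  shows "Ck_vec k U f"
  using assms by (auto simp: Ck_vec_def Basis_vec_def inner_axis intro: ratfun_Ck_on)

section \<open>The integrand and its Cahn--Hoffman map\<close>

abbreviation e3 :: "real^3" where "e3 \<equiv> axis 3 1"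

definition gam :: "real^3 \<Rightarrow> real" where
  "gam \<nu> = 70 - 27 * (\<nu> $ 3)^2 - 25 * (\<nu> $ 3)^4"

definition CH :: "real^3 \<Rightarrow> real^3" where
  "CH y = (- 54 * y $ 3 - 100 * (y $ 3)^3) *\<^sub>R e3
        + (70 + 27 * (y $ 3)^2 + 75 * (y $ 3)^4) *\<^sub>R y"

text \<open>The differential of \<open>CH\<close>. The scalar coefficients of \<open>CH\<close> have
  derivatives q = -54 - 300 z^2 and -q z, so the two contributions combine into one multiple of e3 -
  z y. This leaves a multiple of the identity plus a map of rank one.\<close>

definition dCH :: "real^3 \<Rightarrow> real^3 \<Rightarrow> real^3" where
  "dCH y w = (70 + 27 * (y $ 3)^2 + 75 * (y $ 3)^4) *\<^sub>R w
     + ((- 54 - 300 * (y $ 3)^2) * w $ 3) *\<^sub>R (e3 - (y $ 3) *\<^sub>R y)"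

lemma CH_deriv:
  assumes c: "(c has_vector_derivative w) (at t)"
  shows "((\<lambda>t. CH (c t)) has_vector_derivative dCH (c t) w) (at t)"
proof -
  have c3: "((\<lambda>t. c t $ 3) has_real_derivative w $ 3) (at t)"
    using bounded_linear.has_vector_derivative[OF bounded_linear_vec_nth c, of 3]
    by (simp add: has_real_derivative_iff_has_vector_derivative)
  have 1: "((\<lambda>t. (- 54 * c t $ 3 - 100 * (c t $ 3)^3)) has_real_derivative
      (- 54 - 300 * (c t $ 3)^2) * w $ 3) (at t)"
    by (rule derivative_eq_intros c3 refl | simp add: algebra_simps)+
  have 2: "((\<lambda>t. (70 + 27 * (c t $ 3)^2 + 75 * (c t $ 3)^4)) has_real_derivative
      - ((- 54 - 300 * (c t $ 3)^2) * w $ 3 * c t $ 3)) (at t)"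
    by (rule derivative_eq_intros c3 refl | simp add: algebra_simps power3_eq_cube power2_eq_square)+
  show ?thesis
    unfolding CH_def
    by (rule has_vector_derivative_eq_rhs[OF has_vector_derivative_add[OF
            has_vector_derivative_scaleR[OF 1 has_vector_derivative_const]
            has_vector_derivative_scaleR[OF 2 c]]])
      (simp add: dCH_def algebra_simps)
qed

text \<open>Lagrange's formula gives n x (v x w) = 0, and a second cross product with n turns this
  into the claim. It lets orientations on tangent planes be compared through a single
  scalar.\<close>

lemma cross3_orthogonal_to_unit:
  fixes v w n :: "real^3"
  assumes "v \<bullet> n = 0" "w \<bullet> n = 0" "norm n = 1"
  shows "cross3 v w = (cross3 v w \<bullet> n) *\<^sub>R n"
proof -
  have nn: "n \<bullet> n = 1" using assms(3) by (simp add: dot_square_norm)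
  have "cross3 n (cross3 v w) = 0"
    using assms by (simp add: Lagrange inner_commute)
  then have "cross3 n (cross3 n (cross3 v w)) = 0" by simp
  then show ?thesis
    unfolding Lagrange[of n n "cross3 v w"] nn by (simp add: inner_commute)
qed

lemma norm_eq_1_iff_3: "norm (p::real^3) = 1 \<longleftrightarrow> (p$1)^2 + (p$2)^2 + (p$3)^2 = 1"
  by (simp add: norm_eq_1 inner_vec_def sum_3 power2_eq_square)

lemma S2_iff: "p \<in> S2 \<longleftrightarrow> (p$1)^2 + (p$2)^2 + (p$3)^2 = 1"
  by (simp add: S2_def norm_eq_1_iff_3)

lemma S2_norm: "p \<in> S2 \<longleftrightarrow> norm p = 1"
  by (simp add: S2_def)

lemma S2_inner: "p \<in> S2 \<longleftrightarrow> p \<bullet> p = 1"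
  by (simp add: S2_def norm_eq_1)

text \<open>For a function g(z) of the height the spherical gradient is g'(z) times the tangential
  part of e3. Collecting terms gives g' e3 + (g - z g') \<nu>, which is the polynomial map
  \<open>CH\<close>.\<close>

lemma cahn_hoffman_gam:
  assumes "\<nu> \<in> S2"
  shows "cahn_hoffman gam \<nu> = CH \<nu>"
proof -
  define z where "z = \<nu> $ 3"
  define u where "u = (- 54 * z - 100 * z^3) *\<^sub>R (e3 - z *\<^sub>R \<nu>)"
  have nn: "\<nu> \<bullet> \<nu> = 1" using assms by (simp add: S2_inner)
  have ut: "u \<in> tang \<nu>"
    using nn by (simp add: u_def tang_def inner_diff_left inner_axis' z_def)
  have deriv: "((\<lambda>t. gam (cos t *\<^sub>R \<nu> + sin t *\<^sub>R w)) has_real_derivative u \<bullet> w) (at 0)"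
    if "w \<in> tang \<nu>" for w
  proof -
    have w: "\<nu> \<bullet> w = 0" using that by (simp add: tang_def inner_commute)
    show ?thesis unfolding gam_def
      by (auto intro!: derivative_eq_intros
          simp: u_def w inner_diff_left inner_axis' z_def[symmetric] algebra_simps)
  qed
  have "sgrad gam \<nu> = u" unfolding sgrad_def
  proof (rule the_equality, intro conjI ballI impI)
    fix v
    assume v: "v \<in> tang \<nu> \<and> (\<forall>w\<in>tang \<nu>. norm w = 1 \<longrightarrow>
      ((\<lambda>t. gam (cos t *\<^sub>R \<nu> + sin t *\<^sub>R w)) has_real_derivative v \<bullet> w) (at 0))"
    show "v = u"
    proof (rule ccontr)
      assume "v \<noteq> u"
      \<comment> \<open>Two candidates for the gradient are compared in the one unit direction along
        their difference.\<close>
      define w where "w = (v - u) /\<^sub>R norm (v - u)"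
      have "w \<in> tang \<nu>" "norm w = 1"
        using v ut \<open>v \<noteq> u\<close> by (auto simp: w_def tang_def inner_diff_left)
      then have "v \<bullet> w = u \<bullet> w"
        using v deriv DERIV_unique by blast
      then have "(v - u) \<bullet> w = 0" by (simp add: inner_diff_left)
      then show False using \<open>v \<noteq> u\<close> by (simp add: w_def)
    qed
  qed (use ut deriv in auto)
  then have "cahn_hoffman gam \<nu> = (- 54 * z - 100 * z^3) *\<^sub>R e3
      + (gam \<nu> - (- 54 * z - 100 * z^3) * z) *\<^sub>R \<nu>"
    by (simp add: cahn_hoffman_def u_def algebra_simps)
  also have "gam \<nu> - (- 54 * z - 100 * z^3) * z = 70 + 27 * z^2 + 75 * z^4"
    by (simp add: gam_def z_def[symmetric] algebra_simps
        power2_eq_square power3_eq_cube power4_eq_xxxx)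
  finally show ?thesis by (simp add: CH_def z_def)
qed

lemma CH_3: "CH y $ 3 = y $ 3 * (25 * (y $ 3)^2 - 16) * (3 * (y $ 3)^2 - 1)"
  by (simp add: CH_def algebra_simps power2_eq_square power3_eq_cube power4_eq_xxxx)

text \<open>This quartic is the derivative of the height polynomial in \<open>CH_3\<close> and also
  the eigenvalue of \<open>dCH\<close> in the meridian direction. On the caps 375 z^2 is at least
  240, which exceeds 219.\<close>

lemma CH_jacobian_pos:
  fixes z :: real
  assumes "16/25 \<le> z^2"
  shows "0 < 16 - 219 * z^2 + 375 * z^4"
proof -
  have "16 - 219 * z^2 + 375 * z^4 = 16 + (z^2) * (375 * (z^2) - 219)"
    by (simp add: algebra_simps power2_eq_square power4_eq_xxxx)
  also have "\<dots> > 0" using assms by (intro add_pos_nonneg mult_nonneg_nonneg) auto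
  finally show ?thesis .
qed


lemma dCH_normal:
  assumes "\<nu> \<in> S2" "w \<bullet> \<nu> = 0"
  shows "dCH \<nu> w \<bullet> \<nu> = 0"
  using assms by (simp add: dCH_def inner_add_left inner_diff_left inner_axis' S2_inner)

text \<open>Serves both \<open>dCH\<close> and \<open>dboost\<close>, which share this shape. The
  multiple s n disappears because a triple product with n as two of its entries vanishes.\<close>

lemma cross3_rank_one_update:
  fixes v w e n :: "real^3"
  shows "cross3 (b *\<^sub>R v + (q * v $ 3) *\<^sub>R (e3 - s *\<^sub>R n)) (b *\<^sub>R w + (q * w $ 3) *\<^sub>R (e3 - s *\<^sub>R n)) \<bullet> n
    = b * ((b + q) * (cross3 v w \<bullet> n) - q * cross3 v w $ 3 * n $ 3)"
  by (simp add: cross3_def inner_vec_def sum_3 axis_def algebra_simps)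

lemma dCH_orientation:
  assumes n: "\<nu> \<in> S2" "v \<bullet> \<nu> = 0" "w \<bullet> \<nu> = 0"
  shows "cross3 (dCH \<nu> v) (dCH \<nu> w) \<bullet> \<nu>
    = (70 + 27 * (\<nu> $ 3)^2 + 75 * (\<nu> $ 3)^4) * (16 - 219 * (\<nu> $ 3)^2 + 375 * (\<nu> $ 3)^4)
      * (cross3 v w \<bullet> \<nu>)"
proof -
  define c where "c = cross3 v w \<bullet> \<nu>"
  have "cross3 v w = c *\<^sub>R \<nu>"
    using cross3_orthogonal_to_unit[of v \<nu> w] n by (simp add: c_def S2_norm)
  then have c3: "cross3 v w $ 3 = c * \<nu> $ 3" by simp
  show ?thesis
    unfolding dCH_def cross3_rank_one_update c3 c_def[symmetric]
    by (simp add: algebra_simps power2_eq_square power4_eq_xxxx)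
qed

section \<open>The two caps\<close>

text \<open>A conformal (Moebius) diffeomorphism of the sphere carrying the hemisphere
  \<open>0 \<le> \<sigma> * p $ 3\<close> onto the cap \<open>4/5 \<le> \<sigma> * \<nu> $ 3\<close>.\<close>
definition boost :: "real \<Rightarrow> real^3 \<Rightarrow> real^3" where
  "boost \<sigma> p = (1 / (5 + 4 * \<sigma> * p $ 3)) *\<^sub>R (3 *\<^sub>R p + (2 * p $ 3 + 4 * \<sigma>) *\<^sub>R e3)"

definition hemi :: "real \<Rightarrow> (real^3) set" where
  "hemi \<sigma> = {p \<in> S2. 0 \<le> \<sigma> * p $ 3}"

lemma boost_nth:
  "boost \<sigma> p $ 1 = 3 * p $ 1 / (5 + 4 * \<sigma> * p $ 3)"
  "boost \<sigma> p $ 2 = 3 * p $ 2 / (5 + 4 * \<sigma> * p $ 3)"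
  "boost \<sigma> p $ 3 = (5 * p $ 3 + 4 * \<sigma>) / (5 + 4 * \<sigma> * p $ 3)"
  by (simp_all add: boost_def axis_def)

lemma sign_cases: "(\<sigma>::real)^2 = 1 \<Longrightarrow> \<sigma> = 1 \<or> \<sigma> = -1"
  by (simp add: power2_eq_1_iff)

lemma boost_denom_pos:
  assumes "(\<sigma>::real)^2 = 1" "\<bar>z\<bar> < 5/4"
  shows "0 < 5 + 4 * \<sigma> * z"
  using sign_cases[OF assms(1)] assms(2) by auto

lemma S2_nth_le_1: "p \<in> S2 \<Longrightarrow> \<bar>p $ i\<bar> \<le> 1"
  using component_le_norm_cart[of p i] by (simp add: S2_norm)

lemma boost_denom_pos_S2:
  assumes "\<sigma>^2 = 1" "p \<in> S2"
  shows "0 < 5 + 4 * \<sigma> * p $ 3"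
  using boost_denom_pos[OF assms(1)] S2_nth_le_1[OF assms(2), of 3] by simp

lemma boost_S2:
  assumes s: "\<sigma>^2 = 1" and p: "p \<in> S2"
  shows "boost \<sigma> p \<in> S2"
proof -
  define D where "D = 5 + 4 * \<sigma> * p $ 3"
  have D: "D > 0" using boost_denom_pos_S2[OF s p] by (simp add: D_def)
  have p2: "(p$1)^2 + (p$2)^2 = 1 - (p$3)^2" using p by (simp add: S2_iff)
  have "9 * ((p$1)^2 + (p$2)^2) + (5 * p$3 + 4 * \<sigma>)^2 = D^2"
    unfolding p2 D_def using s by (simp add: power2_sum power_mult_distrib)
  then have "(3 * p$1)^2 + (3 * p$2)^2 + (5 * p$3 + 4 * \<sigma>)^2 = D^2"
    by (simp add: power_mult_distrib)
  then show ?thesis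
    using D unfolding S2_iff boost_nth D_def[symmetric]
    by (simp add: power_divide flip: add_divide_distrib)
qed

text \<open>The differential of \<open>boost\<close>. By the quotient rule the denominator
  contributes the term with 2 \<sigma> \<open>boost\<close>, so that the formula fits
  \<open>cross3_rank_one_update\<close>.\<close>

definition dboost :: "real \<Rightarrow> real^3 \<Rightarrow> real^3 \<Rightarrow> real^3" where
  "dboost \<sigma> p v = (1 / (5 + 4 * \<sigma> * p $ 3)) *\<^sub>R
     (3 *\<^sub>R v + (2 * v $ 3) *\<^sub>R (e3 - (2 * \<sigma>) *\<^sub>R boost \<sigma> p))"

lemma boost_deriv:
  assumes c: "(c has_vector_derivative v) (at t)" and D: "5 + 4 * \<sigma> * c t $ 3 \<noteq> 0"
  shows "((\<lambda>t. boost \<sigma> (c t)) has_vector_derivative dboost \<sigma> (c t) v) (at t)"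
proof -
  have c3: "((\<lambda>t. c t $ 3) has_real_derivative v $ 3) (at t)"
    using bounded_linear.has_vector_derivative[OF bounded_linear_vec_nth c, of 3]
    by (simp add: has_real_derivative_iff_has_vector_derivative)
  define D where "D = 5 + 4 * \<sigma> * c t $ 3"
  have 1: "((\<lambda>t. 1 / (5 + 4 * \<sigma> * c t $ 3)) has_real_derivative
      - (4 * \<sigma> * v $ 3) * (1 / D) * (1 / D)) (at t)"
    using D by (auto intro!: derivative_eq_intros c3 simp: D_def power2_eq_square)
  have 2: "((\<lambda>t. 2 * c t $ 3 + 4 * \<sigma>) has_real_derivative 2 * v $ 3) (at t)"
    by (auto intro!: derivative_eq_intros c3)
  have 3: "((\<lambda>t. 3 *\<^sub>R c t + (2 * c t $ 3 + 4 * \<sigma>) *\<^sub>R e3) has_vector_derivative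
      3 *\<^sub>R v + (2 * v $ 3) *\<^sub>R e3) (at t)"
    by (rule has_vector_derivative_eq_rhs[OF has_vector_derivative_add[OF
            has_vector_derivative_scaleR[OF DERIV_const c]
            has_vector_derivative_scaleR[OF 2 has_vector_derivative_const]]]) simp
  show ?thesis
    unfolding boost_def
    by (rule has_vector_derivative_eq_rhs[OF has_vector_derivative_scaleR[OF 1 3]],
        unfold dboost_def boost_def D_def[symmetric]) (simp add: algebra_simps)
qed

lemma dboost_normal:
  assumes s: "\<sigma>^2 = 1" and p: "p \<in> S2" and v: "v \<bullet> p = 0"
  shows "dboost \<sigma> p v \<bullet> boost \<sigma> p = 0"
proof -
  define D where "D = 5 + 4 * \<sigma> * p $ 3"
  have D: "D \<noteq> 0" using boost_denom_pos_S2[OF s p] by (simp add: D_def)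
  have vb: "v \<bullet> boost \<sigma> p = (2 * p $ 3 + 4 * \<sigma>) * v $ 3 / D"
    using v by (simp add: boost_def inner_add_right inner_axis D_def)
  \<comment> \<open>Up to the factor 1/D this is the inner product to be shown zero, because
    \<open>boost\<close> has unit length on the sphere.\<close>
  have "3 * (v \<bullet> boost \<sigma> p) + 2 * v $ 3 * (boost \<sigma> p $ 3 - 2 * \<sigma>) = 0"
  proof -
    have "3 * (2 * p $ 3 + 4 * \<sigma>) + 2 * (5 * p $ 3 + 4 * \<sigma>) - 4 * \<sigma> * D
        = 16 * p $ 3 * (1 - \<sigma>^2)"
      by (simp add: D_def algebra_simps power2_eq_square)
    moreover have "3 * ((2 * p $ 3 + 4 * \<sigma>) * v $ 3 / D)
        + 2 * v $ 3 * ((5 * p $ 3 + 4 * \<sigma>) / D - 2 * \<sigma>)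
      = v $ 3 * (3 * (2 * p $ 3 + 4 * \<sigma>) + 2 * (5 * p $ 3 + 4 * \<sigma>) - 4 * \<sigma> * D) / D"
      using D by (simp add: field_simps)
    ultimately show ?thesis
      unfolding vb boost_nth D_def[symmetric] by (simp add: s)
  qed
  then show ?thesis
    using boost_S2[OF s p]
    by (simp add: dboost_def inner_add_left inner_diff_left inner_axis' S2_inner)
qed

text \<open>The area factor is the square of the conformal factor 3/D of the Moebius map, D being
  the denominator of \<open>boost\<close>.\<close>

lemma dboost_orientation:
  assumes s: "\<sigma>^2 = 1" and p: "p \<in> S2" and v: "v \<bullet> p = 0" and w: "w \<bullet> p = 0"
  shows "cross3 (dboost \<sigma> p v) (dboost \<sigma> p w) \<bullet> boost \<sigma> p
     = 9 / (5 + 4 * \<sigma> * p $ 3)^2 * (cross3 v w \<bullet> p)"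
proof -
  define D where "D = 5 + 4 * \<sigma> * p $ 3"
  have D: "D \<noteq> 0" using boost_denom_pos_S2[OF s p] by (simp add: D_def)
  define c where "c = cross3 v w \<bullet> p"
  have V: "cross3 v w = c *\<^sub>R p"
    using cross3_orthogonal_to_unit[of v p w] v w p by (simp add: c_def S2_norm)
  have pb: "p \<bullet> boost \<sigma> p = (3 + (2 * p $ 3 + 4 * \<sigma>) * p $ 3) / D"
    using p by (simp add: boost_def inner_add_right inner_axis D_def S2_inner)
  have eq: "dboost \<sigma> p u = (1 / D) *\<^sub>R (3 *\<^sub>R u + (2 * u $ 3) *\<^sub>R (e3 - (2 * \<sigma>) *\<^sub>R boost \<sigma> p))" for u
    by (simp add: dboost_def D_def)
  \<comment> \<open>With b = 3 and q = 2 in \<open>cross3_rank_one_update\<close>, the determinant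
    reduces to three times this expression.\<close>
  have "5 * (p \<bullet> boost \<sigma> p) - 2 * p $ 3 * boost \<sigma> p $ 3 = 3"
    unfolding pb boost_nth D_def[symmetric] using D s
    by (simp add: field_simps) (simp add: D_def algebra_simps power2_eq_square)
  then have "5 * (c * (p \<bullet> boost \<sigma> p)) - 2 * (c * p $ 3) * boost \<sigma> p $ 3 = c * 3"
    by (metis (no_types) mult.left_commute mult.assoc right_diff_distrib)
  then show ?thesis
    unfolding eq cross_mult_left cross_mult_right inner_scaleR_left cross3_rank_one_update V
    using D p by (simp add: D_def[symmetric] V power2_eq_square S2_inner)
qed

lemma hemi_boost_3:
  assumes s: "\<sigma>^2 = 1" and p: "p \<in> hemi \<sigma>"
  shows "4/5 \<le> \<sigma> * boost \<sigma> p $ 3" "\<sigma> * boost \<sigma> p $ 3 \<le> 1"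
proof -
  define z where "z = \<sigma> * p $ 3"
  have z: "0 \<le> z" "z \<le> 1"
    using p S2_nth_le_1[of p 3] sign_cases[OF s] by (auto simp: hemi_def z_def)
  have "\<sigma> * boost \<sigma> p $ 3 = (5 * z + 4) / (5 + 4 * z)"
    using s by (simp add: boost_nth z_def algebra_simps power2_eq_square)
  note eq = this
  show "4/5 \<le> \<sigma> * boost \<sigma> p $ 3" "\<sigma> * boost \<sigma> p $ 3 \<le> 1"
    unfolding eq using z by (simp_all add: field_simps)
qed

lemma hemi_boost_3_sq:
  assumes "\<sigma>^2 = 1" "p \<in> hemi \<sigma>"
  shows "16/25 \<le> (boost \<sigma> p $ 3)^2"
proof -
  have "(4/5)^2 \<le> (\<sigma> * boost \<sigma> p $ 3)^2"
    by (rule power_mono) (use hemi_boost_3[OF assms] in auto)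
  then show ?thesis using assms(1) by (simp add: power_mult_distrib power_divide)
qed

abbreviation cap :: "real \<Rightarrow> real^3 \<Rightarrow> real^3" where "cap \<sigma> p \<equiv> CH (boost \<sigma> p)"
abbreviation dcap :: "real \<Rightarrow> real^3 \<Rightarrow> real^3 \<Rightarrow> real^3"
  where "dcap \<sigma> p v \<equiv> dCH (boost \<sigma> p) (dboost \<sigma> p v)"

text \<open>The two Jacobian factors multiply, and both are positive on the hemisphere. This one
  fact yields the immersion property, the orientation of the normal and a nonzero denominator in the
  mean curvature.\<close>

lemma dcap_orientation:
  assumes s: "\<sigma>^2 = 1" and p: "p \<in> hemi \<sigma>"
  obtains \<kappa> where "\<kappa> > 0" "\<And>v w. v \<in> tang p \<Longrightarrow> w \<in> tang p \<Longrightarrow>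
     cross3 (dcap \<sigma> p v) (dcap \<sigma> p w) \<bullet> boost \<sigma> p = \<kappa> * (cross3 v w \<bullet> p)"
proof
  let ?z = "boost \<sigma> p $ 3" and ?D = "5 + 4 * \<sigma> * p $ 3"
  let ?k = "(70 + 27 * ?z^2 + 75 * ?z^4) * (16 - 219 * ?z^2 + 375 * ?z^4) * (9 / ?D^2)"
  have pS: "p \<in> S2" using p by (simp add: hemi_def)
  have "70 + 27 * ?z^2 + 75 * ?z^4 > 0"
    by (intro add_pos_nonneg) auto
  then show "?k > 0"
    using CH_jacobian_pos[OF hemi_boost_3_sq[OF s p]] boost_denom_pos_S2[OF s pS] by simp
  fix v w assume "v \<in> tang p" "w \<in> tang p"
  then have vw: "v \<bullet> p = 0" "w \<bullet> p = 0" by (auto simp: tang_def)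
  show "cross3 (dcap \<sigma> p v) (dcap \<sigma> p w) \<bullet> boost \<sigma> p = ?k * (cross3 v w \<bullet> p)"
    using dCH_orientation[OF boost_S2[OF s pS] dboost_normal[OF s pS vw(1)]
        dboost_normal[OF s pS vw(2)]] dboost_orientation[OF s pS vw] by simp
qed

section \<open>The surface\<close>

definition surf :: "real^3 \<Rightarrow> real^3" where
  "surf p = (if p $ 3 \<ge> 0 then cap 1 p else cap (-1) p)"

text \<open>Over the equator \<open>boost\<close> has height 4 \<sigma> / 5 and shrinks the
  horizontal part by 3/5. There the coefficient of y in \<open>CH\<close> is 118, and 118 * 3/5 =
  354/5. Since \<sigma> drops out, the two caps agree along the edge.\<close>

lemma cap_equator:
  assumes "\<sigma>^2 = 1" "p $ 3 = 0"
  shows "cap \<sigma> p $ 1 = 354/5 * p $ 1" "cap \<sigma> p $ 2 = 354/5 * p $ 2" "cap \<sigma> p $ 3 = 0"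
  using sign_cases[OF assms(1)] assms(2)
  by (auto simp: CH_def boost_nth axis_def power2_eq_square power3_eq_cube power4_eq_xxxx)

lemma surf_hemi:
  assumes s: "\<sigma>^2 = 1" and p: "p \<in> hemi \<sigma>"
  shows "surf p = cap \<sigma> p"
proof (cases "p $ 3 = 0")
  case True
  then have "cap 1 p = cap \<sigma> p"
    using cap_equator[OF s True] cap_equator[of 1 p] by (simp add: vec_eq_iff forall_3)
  then show ?thesis using True by (simp add: surf_def)
next
  case False
  then show ?thesis using sign_cases[OF s] p by (auto simp: surf_def hemi_def)
qed

text \<open>From 4/5 on, all three factors are nonnegative and strictly increasing.\<close>

lemma CH_height_strict_mono:
  fixes x y :: real
  assumes "4/5 \<le> x" "x < y"
  shows "x * (25 * x^2 - 16) * (3 * x^2 - 1) < y * (25 * y^2 - 16) * (3 * y^2 - 1)"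
proof -
  have sq: "x^2 < y^2" "(4/5)^2 \<le> x^2"
    using assms by (auto intro!: power_strict_mono power_mono)
  then have sq': "16/25 \<le> x^2" by (simp add: power_divide)
  show ?thesis
    by (intro mult_strict_mono' mult_strict_mono mult_nonneg_nonneg) (use assms sq sq' in auto)
qed

text \<open>The height polynomial is odd, so the sign \<sigma> can be moved into its argument and
  both caps are treated at once.\<close>

lemma hemi_height:
  assumes s: "\<sigma>^2 = 1" and p: "p \<in> hemi \<sigma>"
  defines "x \<equiv> \<sigma> * boost \<sigma> p $ 3"
  shows "\<sigma> * surf p $ 3 = x * (25 * x^2 - 16) * (3 * x^2 - 1)"
  using s unfolding surf_hemi[OF s p] CH_3 by (simp add: x_def power_mult_distrib)

text \<open>The increasing height polynomial runs from 0 at 4/5 to 18 at 1. Height 0 is thus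
  attained only at the edge, which keeps the two caps apart.\<close>

lemma hemi_height_nonneg:
  assumes s: "\<sigma>^2 = 1" and p: "p \<in> hemi \<sigma>"
  shows "0 \<le> \<sigma> * surf p $ 3" "\<sigma> * surf p $ 3 \<le> 18"
    "\<sigma> * surf p $ 3 = 0 \<Longrightarrow> p $ 3 = 0"
proof -
  define x where "x = \<sigma> * boost \<sigma> p $ 3"
  have x: "4/5 \<le> x" "x \<le> 1" using hemi_boost_3[OF s p] by (auto simp: x_def)
  have h: "\<sigma> * surf p $ 3 = x * (25 * x^2 - 16) * (3 * x^2 - 1)"
    using hemi_height[OF s p] by (simp add: x_def)
  have edge: "\<sigma> * surf p $ 3 = 0" if "x = 4/5"
    unfolding h that by (simp add: power_divide)
  have off_edge: "0 < \<sigma> * surf p $ 3" if "x \<noteq> 4/5"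
    using CH_height_strict_mono[of "4/5" x] x that unfolding h by (simp add: power_divide)
  show "0 \<le> \<sigma> * surf p $ 3" using edge off_edge by fastforce
  show "\<sigma> * surf p $ 3 \<le> 18"
    using CH_height_strict_mono[of x 1] x unfolding h by (cases "x = 1") auto
  assume "\<sigma> * surf p $ 3 = 0"
  then have "x = 4/5" using off_edge by fastforce
  moreover have "5 + 4 * \<sigma> * p $ 3 > 0"
    using boost_denom_pos_S2[OF s] p by (simp add: hemi_def)
  \<comment> \<open>The equation x = 4/5 with its denominator cleared; as \<sigma>^2 = 1 it says 9
    \<sigma> p_3 = 0.\<close>
  ultimately have "25 * (\<sigma> * p $ 3) + 20 * \<sigma>^2 = 20 + 16 * \<sigma> * p $ 3"
    by (simp add: x_def boost_nth field_simps power2_eq_square)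
  then show "p $ 3 = 0" using s by auto
qed

section \<open>Injectivity of the surface\<close>

lemma boost_inj:
  assumes s: "\<sigma>^2 = 1" and p: "p \<in> S2" and q: "q \<in> S2" and eq: "boost \<sigma> p = boost \<sigma> q"
  shows "p = q"
proof -
  define D E where "D = 5 + 4 * \<sigma> * p $ 3" and "E = 5 + 4 * \<sigma> * q $ 3"
  have D: "D > 0" "E > 0"
    using boost_denom_pos_S2[OF s p] boost_denom_pos_S2[OF s q] by (simp_all add: D_def E_def)
  have "(5 * p $ 3 + 4 * \<sigma>) * E = (5 * q $ 3 + 4 * \<sigma>) * D"
    using arg_cong[OF eq, of "\<lambda>v. v $ 3"] D
    unfolding boost_nth D_def[symmetric] E_def[symmetric] by (simp add: frac_eq_eq)
  \<comment> \<open>On heights \<open>boost\<close> acts as a fractional linear map, whose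
    determinant 25 - 16 \<sigma>^2 is 9.\<close>
  then have "(25 - 16 * \<sigma>^2) * (p $ 3 - q $ 3) = 0"
    by (simp add: D_def E_def algebra_simps power2_eq_square)
  then have 3: "p $ 3 = q $ 3" using s by simp
  then have "D = E" by (simp add: D_def E_def)
  then have "p $ 1 = q $ 1" "p $ 2 = q $ 2"
    using arg_cong[OF eq, of "\<lambda>v. v $ 1"] arg_cong[OF eq, of "\<lambda>v. v $ 2"] D
    by (simp_all add: boost_nth D_def[symmetric] E_def[symmetric])
  with 3 show ?thesis by (simp add: vec_eq_iff forall_3)
qed

text \<open>Monotonicity recovers the height of the normal from the height of the point. The
  coefficients of \<open>CH\<close> depend on that height only, so they cancel and the normals
  agree.\<close>

lemma surf_inj_hemi:
  assumes s: "\<sigma>^2 = 1" and p: "p \<in> hemi \<sigma>" and q: "q \<in> hemi \<sigma>" and eq: "surf p = surf q"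
  shows "p = q"
proof -
  have s0: "\<sigma> \<noteq> 0" using s by auto
  have "\<sigma> * boost \<sigma> p $ 3 = \<sigma> * boost \<sigma> q $ 3"
    using CH_height_strict_mono[of "\<sigma> * boost \<sigma> p $ 3" "\<sigma> * boost \<sigma> q $ 3"]
      CH_height_strict_mono[of "\<sigma> * boost \<sigma> q $ 3" "\<sigma> * boost \<sigma> p $ 3"]
      hemi_height[OF s p] hemi_height[OF s q] eq hemi_boost_3(1)[OF s p] hemi_boost_3(1)[OF s q]
    by (metis less_irrefl linorder_neqE_linordered_idom)
  then have 3: "boost \<sigma> p $ 3 = boost \<sigma> q $ 3" using s0 by simp
  define z b where "z = boost \<sigma> q $ 3" and "b = 70 + 27 * z^2 + 75 * z^4"
  have "b > 0" unfolding b_def by (intro add_pos_nonneg) auto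
  moreover have "b *\<^sub>R boost \<sigma> p = b *\<^sub>R boost \<sigma> q"
    using eq unfolding surf_hemi[OF s p] surf_hemi[OF s q] CH_def 3 z_def[symmetric]
      b_def[symmetric] by simp
  ultimately have "boost \<sigma> p = boost \<sigma> q" by simp
  then show ?thesis using boost_inj[OF s] p q by (simp add: hemi_def)
qed

lemma S2_hemi_cases:
  assumes "p \<in> S2"
  obtains \<sigma> where "\<sigma>^2 = 1" "p \<in> hemi \<sigma>"
  using assms by (cases "p $ 3 \<ge> 0") (auto simp: hemi_def intro: that[of 1] that[of "-1"])

text \<open>Images of opposite hemispheres have heights of opposite sign. If they coincide, the
  height is 0 and the point lies on the equator, hence in both hemispheres.\<close>

lemma surf_inj: "inj_on surf S2"
proof (rule inj_onI)
  fix p q assume p: "p \<in> S2" and q: "q \<in> S2" and eq: "surf p = surf q"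
  obtain \<sigma> where s: "\<sigma>^2 = 1" "p \<in> hemi \<sigma>" using S2_hemi_cases[OF p] .
  show "p = q"
  proof (cases "q \<in> hemi \<sigma>")
    case True
    then show ?thesis using surf_inj_hemi s eq by blast
  next
    case False
    then have q': "q \<in> hemi (- \<sigma>)" using q by (auto simp: hemi_def)
    have "\<sigma> * surf q $ 3 = 0"
      using hemi_height_nonneg(1)[OF s] hemi_height_nonneg(1)[OF _ q'] s(1) eq by simp
    then have "q $ 3 = 0"
      using hemi_height_nonneg(3)[OF _ q'] s(1) by simp
    then show ?thesis using False q by (simp add: hemi_def)
  qed
qed


section \<open>Derivatives along the curves \<open>scurve\<close>\<close>

lemma scurve_norm:
  assumes "p \<in> S2" "v \<in> tang p"
  shows "norm (p + t *\<^sub>R v) = sqrt (1 + t^2 * (v \<bullet> v))"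
  using assms
  by (simp add: norm_eq_sqrt_inner inner_add_left inner_add_right S2_inner tang_def inner_commute
      power2_eq_square)

lemma scurve_norm_pos:
  assumes "p \<in> S2" "v \<in> tang p"
  shows "norm (p + t *\<^sub>R v) > 0"
  unfolding scurve_norm[OF assms] by (simp add: add_pos_nonneg)

lemma scurve_S2: "p \<in> S2 \<Longrightarrow> v \<in> tang p \<Longrightarrow> scurve p v t \<in> S2"
  using scurve_norm_pos[of p v t] by (simp add: scurve_def S2_norm)

lemma scurve_0: "p \<in> S2 \<Longrightarrow> scurve p v 0 = p"
  by (simp add: scurve_def S2_norm)

text \<open>As v is orthogonal to p, the normalising factor depends on t^2 only and is stationary at
  0.\<close>

lemma scurve_deriv:
  assumes "p \<in> S2" "v \<in> tang p"
  shows "(scurve p v has_vector_derivative v) (at 0)"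
proof -
  have 1: "((\<lambda>t. 1 / sqrt (1 + t^2 * (v \<bullet> v))) has_real_derivative 0) (at 0)"
    by (auto intro!: derivative_eq_intros)
  have 2: "((\<lambda>t. p + t *\<^sub>R v) has_vector_derivative v) (at 0)"
    by (auto intro!: derivative_eq_intros)
  have "((\<lambda>t. (1 / sqrt (1 + t^2 * (v \<bullet> v))) *\<^sub>R (p + t *\<^sub>R v)) has_vector_derivative v) (at 0)"
    by (rule has_vector_derivative_eq_rhs[OF has_vector_derivative_scaleR[OF 1 2]]) simp
  then show ?thesis unfolding scurve_def[abs_def] scurve_norm[OF assms] .
qed

lemma cap_scurve_deriv:
  assumes s: "\<sigma>^2 = 1" and p: "p \<in> S2" and v: "v \<in> tang p"
  shows "((\<lambda>t. cap \<sigma> (scurve p v t)) has_vector_derivative dcap \<sigma> p v) (at 0)"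
  using CH_deriv[OF boost_deriv[OF scurve_deriv[OF p v], of \<sigma>]] boost_denom_pos_S2[OF s p]
  by (simp add: scurve_0[OF p])

text \<open>Off the equator the curve stays in one hemisphere for small t, where \<open>surf\<close>
  is a single smooth cap.\<close>

lemma surf_scurve_deriv:
  assumes s: "\<sigma>^2 = 1" and p: "p \<in> S2" "0 < \<sigma> * p $ 3" and v: "v \<in> tang p"
  shows "((\<lambda>t. surf (scurve p v t)) has_vector_derivative dcap \<sigma> p v) (at 0)"
proof (rule has_vector_derivative_transform_within_open[OF cap_scurve_deriv[OF s p(1) v]])
  let ?T = "{t. 0 < \<sigma> * (p $ 3 + t * v $ 3)}"
  show "open ?T" by (intro open_Collect_less continuous_intros)
  show "0 \<in> ?T" using p by simp
  fix t assume "t \<in> ?T"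
  then have "0 < (1 / norm (p + t *\<^sub>R v)) * (\<sigma> * (p $ 3 + t * v $ 3))"
    by (intro mult_pos_pos[OF divide_pos_pos[OF zero_less_one scurve_norm_pos[OF p(1) v]]]) simp
  then have "scurve p v t \<in> hemi \<sigma>"
    using scurve_S2[OF p(1) v] by (simp add: hemi_def scurve_def mult.left_commute)
  then show "cap \<sigma> (scurve p v t) = surf (scurve p v t)" by (simp add: surf_hemi[OF s])
qed

text \<open>The Cahn--Hoffman field has the same differential \<open>dcap\<close> as the surface, so
  the anisotropic shape operator is minus the identity. The curve never leaves the sphere, where
  \<open>cahn_hoffman gam\<close> equals \<open>CH\<close>.\<close>

lemma cahn_hoffman_scurve_deriv:
  assumes s: "\<sigma>^2 = 1" and p: "p \<in> S2" and v: "v \<in> tang p"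
  shows "((\<lambda>t. cahn_hoffman gam (boost \<sigma> (scurve p v t))) has_vector_derivative dcap \<sigma> p v) (at 0)"
  using cap_scurve_deriv[OF assms]
  by (simp add: cahn_hoffman_gam boost_S2[OF s] scurve_S2[OF p v])

section \<open>The hemispheres as regular domains\<close>

lemma bdS_hemi:
  assumes s: "\<sigma>^2 = 1"
  shows "bdS (hemi \<sigma>) = {p \<in> S2. p $ 3 = 0}"
proof
  have "closure (S2 - hemi \<sigma>) \<subseteq> {x. \<sigma> * x $ 3 \<le> 0}"
    by (rule closure_minimal)
      (auto simp: hemi_def intro!: closed_Collect_le continuous_intros)
  then show "bdS (hemi \<sigma>) \<subseteq> {p \<in> S2. p $ 3 = 0}"
    using s by (fastforce simp: bdS_def hemi_def)
  show "{p \<in> S2. p $ 3 = 0} \<subseteq> bdS (hemi \<sigma>)"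
  proof
    fix p assume p: "p \<in> {p \<in> S2. p $ 3 = 0}"
    \<comment> \<open>The equatorial point is approached from the opposite open hemisphere, along
      the meridian curve in this direction.\<close>
    define v where "v = (- \<sigma>) *\<^sub>R e3"
    have v: "v \<in> tang p" using p by (simp add: v_def tang_def inner_axis')
    have pS: "p \<in> S2" using p by simp
    define a where "a n = scurve p v (inverse (real (Suc n)))" for n
    have "isCont (scurve p v) 0"
      using has_vector_derivative_continuous[OF scurve_deriv[OF pS v]] .
    then have "a \<longlonglongrightarrow> scurve p v 0"
      unfolding a_def by (rule isCont_tendsto_compose[OF _ LIMSEQ_inverse_real_of_nat])
    moreover have "a n \<in> S2 - hemi \<sigma>" for n
    proof -
      define c where "c = (1 / norm (p + inverse (real (Suc n)) *\<^sub>R v)) * inverse (real (Suc n))"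
      have "c > 0" using scurve_norm_pos[OF pS v] unfolding c_def by (intro mult_pos_pos) auto
      moreover have "a n $ 3 = - (\<sigma> * c)"
        using p by (simp add: a_def scurve_def v_def c_def)
      then have "\<sigma> * a n $ 3 = - (\<sigma>^2 * c)" by (simp add: power2_eq_square)
      ultimately show ?thesis
        using s scurve_S2[OF pS v] by (simp add: hemi_def a_def)
    qed
    ultimately have "p \<in> closure (S2 - hemi \<sigma>)"
      unfolding closure_sequential scurve_0[OF pS] by blast
    then show "p \<in> bdS (hemi \<sigma>)" using p by (simp add: bdS_def hemi_def)
  qed
qed

lemma intS_hemi:
  assumes "\<sigma>^2 = 1"
  shows "intS (hemi \<sigma>) = {p \<in> S2. 0 < \<sigma> * p $ 3}"
  using assms unfolding intS_def bdS_hemi[OF assms] by (auto simp: hemi_def less_le)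

text \<open>Inverse stereographic projection from the equatorial point \<open>(\<epsilon>, 0, 0)\<close>, which carries
  the half-plane onto a hemisphere minus that point.\<close>
definition stereo :: "real \<Rightarrow> real \<Rightarrow> real^2 \<Rightarrow> real^3" where
  "stereo \<epsilon> \<sigma> y = vector
    [\<epsilon> * ((y$1)^2 + (y$2)^2 - 1) / ((y$1)^2 + (y$2)^2 + 1),
     2 * y$1 / ((y$1)^2 + (y$2)^2 + 1), 2 * \<sigma> * y$2 / ((y$1)^2 + (y$2)^2 + 1)]"

definition stereo_inv :: "real \<Rightarrow> real \<Rightarrow> real^3 \<Rightarrow> real^2" where
  "stereo_inv \<epsilon> \<sigma> x = vector [x$2 / (1 - \<epsilon> * x$1), \<sigma> * x$3 / (1 - \<epsilon> * x$1)]"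

lemma sum_squares_plus_1_pos: "0 < (a::real)^2 + b^2 + 1"
  by (simp add: add_nonneg_pos)

lemma stereo_S2:
  assumes "\<epsilon>^2 = 1" "\<sigma>^2 = 1"
  shows "stereo \<epsilon> \<sigma> y \<in> S2" "stereo \<epsilon> \<sigma> y $ 1 \<noteq> \<epsilon>"
proof -
  define D where "D = (y$1)^2 + (y$2)^2 + 1"
  have D: "D > 0" using sum_squares_plus_1_pos by (simp add: D_def)
  have "(D - 2)^2 + 4 * ((y$1)^2 + (y$2)^2) = D^2"
    by (simp add: D_def power2_eq_square algebra_simps)
  then have "(D - 2)^2 / D^2 + 4 * (y$1)^2 / D^2 + 4 * (y$2)^2 / D^2 = 1"
    using D by (simp add: field_simps)
  moreover have D2: "(y$1)^2 + (y$2)^2 - 1 = D - 2" by (simp add: D_def)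
  ultimately show "stereo \<epsilon> \<sigma> y \<in> S2"
    using assms unfolding S2_iff stereo_def vector_3 D_def[symmetric] D2
    by (simp add: power_mult_distrib power_divide)
  have "\<epsilon> \<noteq> 0" using assms by auto
  then show "stereo \<epsilon> \<sigma> y $ 1 \<noteq> \<epsilon>"
    using D unfolding stereo_def vector_3 D_def[symmetric] D2
    by (simp add: divide_eq_eq right_diff_distrib)
qed

lemma stereo_inv_stereo:
  assumes "\<epsilon>^2 = 1" "\<sigma>^2 = 1"
  shows "stereo_inv \<epsilon> \<sigma> (stereo \<epsilon> \<sigma> y) = y"
proof -
  define D where "D = (y$1)^2 + (y$2)^2 + 1"
  have D: "D > 0" using sum_squares_plus_1_pos by (simp add: D_def)
  have D2: "(y$1)^2 + (y$2)^2 - 1 = D - 2" by (simp add: D_def)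
  have "1 - \<epsilon> * (\<epsilon> * (D - 2) / D) = 1 - \<epsilon>^2 * ((D - 2) / D)" by (simp add: power2_eq_square)
  then have den: "1 - \<epsilon> * (\<epsilon> * (D - 2) / D) = 2 / D"
    using assms D by (simp add: field_simps)
  have "\<sigma> * (2 * \<sigma> * y$2 / D) = \<sigma>^2 * (2 * y$2 / D)" by (simp add: power2_eq_square)
  then have num: "\<sigma> * (2 * \<sigma> * y$2 / D) = 2 * y$2 / D" using assms by simp
  show ?thesis
    unfolding stereo_inv_def stereo_def vector_3 D_def[symmetric] D2 den num vec_eq_iff forall_2
      vector_2 using D by simp
qed

lemma stereo_stereo_inv:
  assumes e: "\<epsilon>^2 = 1" and s: "\<sigma>^2 = 1" and x: "x \<in> S2" "x $ 1 \<noteq> \<epsilon>"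
  shows "stereo \<epsilon> \<sigma> (stereo_inv \<epsilon> \<sigma> x) = x"
proof -
  define d where "d = 1 - \<epsilon> * x$1"
  have d: "d \<noteq> 0" using sign_cases[OF e] x(2) by (auto simp: d_def)
  have "(x$2)^2 + (x$3)^2 = 1 - (x$1)^2" using x(1) by (simp add: S2_iff)
  \<comment> \<open>Here 1 - x_1^2 = (1 - \<epsilon> x_1)(1 + \<epsilon> x_1); as a result the
    denominator of \<open>stereo\<close> becomes 2/d.\<close>
  also have "\<dots> = d * (2 - d)"
    using e by (simp add: d_def algebra_simps power2_eq_square)
  finally have "(x$2)^2 / d^2 + (x$3)^2 / d^2 = (2 - d) / d"
    using d by (simp add: power2_eq_square flip: add_divide_distrib)
  then have q: "(x$2 / d)^2 + (\<sigma> * x$3 / d)^2 = 2 / d - 1"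
    using s d by (simp add: power_divide power_mult_distrib diff_divide_distrib)
  have "\<epsilon> * (1 - d) = \<epsilon>^2 * x$1" by (simp add: d_def power2_eq_square)
  then have 1: "\<epsilon> * (1 - d) = x$1" using e by simp
  have "\<sigma> * (\<sigma> * x$3) = \<sigma>^2 * x$3" by (simp add: power2_eq_square)
  then have 3: "\<sigma> * (\<sigma> * x$3) = x$3" using s by simp
  have "\<epsilon> * (2 / d - 1 - 1) / (2 / d - 1 + 1) = \<epsilon> * (1 - d)"
    "2 * (x$2 / d) / (2 / d - 1 + 1) = x$2"
    "2 * \<sigma> * (\<sigma> * x$3 / d) / (2 / d - 1 + 1) = \<sigma> * (\<sigma> * x$3)"
    using d by (simp_all add: field_simps)
  then show ?thesis
    unfolding stereo_def stereo_inv_def vector_2 d_def[symmetric] q vec_eq_iff forall_3 vector_3 1 3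
    by blast
qed

lemma stereo_ratfun: "ratfun UNIV (\<lambda>y. stereo \<epsilon> \<sigma> y $ i)"
proof -
  have "\<forall>i. ratfun UNIV (\<lambda>y. stereo \<epsilon> \<sigma> y $ i)"
    unfolding forall_3 stereo_def vector_3
    by (intro conjI ratfun_intros) (use sum_squares_plus_1_pos in \<open>metis less_irrefl\<close>)+
  then show ?thesis by simp
qed

lemma stereo_inv_ratfun:
  assumes "\<epsilon>^2 = 1"
  shows "ratfun {x. x $ 1 \<noteq> \<epsilon>} (\<lambda>x. stereo_inv \<epsilon> \<sigma> x $ i)"
proof -
  have "\<forall>i. ratfun {x. x $ 1 \<noteq> \<epsilon>} (\<lambda>x. stereo_inv \<epsilon> \<sigma> x $ i)"
    unfolding forall_2 stereo_inv_def vector_2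
    by (intro conjI ratfun_intros) (use sign_cases[OF assms] in auto)
  then show ?thesis by simp
qed

lemma stereo_image:
  assumes "\<epsilon>^2 = 1" "\<sigma>^2 = 1"
  shows "range (stereo \<epsilon> \<sigma>) = S2 \<inter> {x. x $ 1 \<noteq> \<epsilon>}"
  using stereo_S2[OF assms] stereo_stereo_inv[OF assms] by (auto intro: range_eqI[OF sym])

lemma stereo_half_plane:
  assumes s: "\<sigma>^2 = 1"
  shows "stereo \<epsilon> \<sigma> y \<in> hemi \<sigma> \<longleftrightarrow> stereo \<epsilon> \<sigma> y \<in> S2 \<and> 0 \<le> y $ 2"
proof -
  have "\<sigma> * stereo \<epsilon> \<sigma> y $ 3 = \<sigma>^2 * (2 * y$2 / ((y$1)^2 + (y$2)^2 + 1))"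
    by (simp add: stereo_def power2_eq_square)
  then show ?thesis
    using s sum_squares_plus_1_pos[of "y$1" "y$2"] by (simp add: hemi_def zero_le_divide_iff)
qed

lemma stereo_image_half_plane:
  assumes "\<epsilon>^2 = 1" "\<sigma>^2 = 1"
  shows "stereo \<epsilon> \<sigma> ` {y. y $ 2 \<ge> 0} = hemi \<sigma> \<inter> {x. x $ 1 \<noteq> \<epsilon>}"
proof -
  have "hemi \<sigma> \<inter> {x. x $ 1 \<noteq> \<epsilon>} = hemi \<sigma> \<inter> range (stereo \<epsilon> \<sigma>)"
    using stereo_image[OF assms] by (auto simp: hemi_def)
  also have "\<dots> = stereo \<epsilon> \<sigma> ` {y. y $ 2 \<ge> 0}"
    using stereo_half_plane[OF assms(2)] stereo_S2(1)[OF assms] by auto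
  finally show ?thesis by simp
qed

text \<open>Each stereographic image of the half-plane misses one equatorial point. The images for
  the two antipodal centres cover the hemisphere and share the point
  \<open>axis 2 1\<close>.\<close>

lemma connected_hemi:
  assumes s: "\<sigma>^2 = 1"
  shows "connected (hemi \<sigma>)"
proof -
  let ?H = "{y::real^2. y $ 2 \<ge> 0}"
  have "convex ?H" by (rule convexI) simp
  then have conn: "connected (stereo \<epsilon> \<sigma> ` ?H)" for \<epsilon>
    using ratfun_Ck_vec[of UNIV "stereo \<epsilon> \<sigma>" 0, OF stereo_ratfun]
    by (intro connected_continuous_image convex_connected)
      (auto simp: Ck_vec_def continuous_on_componentwise[of UNIV "stereo \<epsilon> \<sigma>"]
        intro: continuous_on_subset[of UNIV])
  have "hemi \<sigma> = stereo 1 \<sigma> ` ?H \<union> stereo (-1) \<sigma> ` ?H"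
    using s by (auto simp: stereo_image_half_plane)
  moreover have "axis 2 1 \<in> stereo 1 \<sigma> ` ?H \<inter> stereo (-1) \<sigma> ` ?H"
    using s by (simp add: stereo_image_half_plane hemi_def S2_iff axis_def)
  ultimately show ?thesis
    using connected_Un[OF conn[of 1] conn[of "-1"]] by auto
qed

lemma compact_hemi: "compact (hemi \<sigma>)"
proof -
  have "hemi \<sigma> = S2 \<inter> {p. 0 \<le> \<sigma> * p $ 3}" by (auto simp: hemi_def)
  moreover have "closed {p::real^3. 0 \<le> \<sigma> * p $ 3}"
    by (intro closed_Collect_le continuous_intros)
  ultimately show ?thesis by (simp add: S2_def compact_Int_closed)
qed

text \<open>One of the two centres differs from p, and the chart from that centre, defined on the
  whole plane, serves at p.\<close>

lemma regular_domain_hemi: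
  assumes s: "\<sigma>^2 = 1"
  shows "regular_domain (hemi \<sigma>)"
  unfolding regular_domain_def
proof (intro conjI ballI)
  show "hemi \<sigma> \<subseteq> S2" by (auto simp: hemi_def)
  show "compact (hemi \<sigma>)" by (rule compact_hemi)
  show "connected (hemi \<sigma>)" by (rule connected_hemi[OF s])
  fix p assume "p \<in> hemi \<sigma>"
  obtain \<epsilon> where e: "\<epsilon>^2 = 1" "p $ 1 \<noteq> \<epsilon>"
    by (cases "p $ 1 = 1") (auto intro: that[of 1] that[of "-1"])
  let ?W = "{x::real^3. x $ 1 \<noteq> \<epsilon>}"
  have W: "open ?W" by (intro open_Collect_neq continuous_intros)
  have inj: "inj_on (stereo \<epsilon> \<sigma>) UNIV"
    using stereo_inv_stereo[OF e(1) s] by (rule inj_on_inverseI)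
  have "Cinf_vec UNIV (stereo \<epsilon> \<sigma>)"
    unfolding Cinf_vec_def by (intro allI ratfun_Ck_vec stereo_ratfun)
  moreover have "Cinf_set (S2 \<inter> ?W) (stereo_inv \<epsilon> \<sigma>)"
    unfolding Cinf_set_def Cinf_vec_def
    by (rule exI[of _ ?W], rule exI[of _ "stereo_inv \<epsilon> \<sigma>"])
      (auto intro!: ratfun_Ck_vec stereo_inv_ratfun e W)
  ultimately show "\<exists>W \<Omega> (\<psi>::real^2 \<Rightarrow> real^3). open W \<and> p \<in> W \<and> open \<Omega> \<and>
        Cinf_vec \<Omega> \<psi> \<and> inj_on \<psi> \<Omega> \<and> \<psi> ` \<Omega> = S2 \<inter> W \<and>
        (\<exists>\<phi>::real^3 \<Rightarrow> real^2. Cinf_set (S2 \<inter> W) \<phi> \<and> (\<forall>y\<in>\<Omega>. \<phi> (\<psi> y) = y)) \<and>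
        \<psi> ` (\<Omega> \<inter> {y. y $ 2 \<ge> 0}) = hemi \<sigma> \<inter> W"
    using W e inj stereo_inv_stereo[OF e(1) s] stereo_image[OF e(1) s]
      stereo_image_half_plane[OF e(1) s]
    by (intro exI[of _ ?W] exI[of _ UNIV] exI[of _ "stereo \<epsilon> \<sigma>"] conjI
        exI[of _ "stereo_inv \<epsilon> \<sigma>"]) auto
qed


section \<open>The CAMC property\<close>

text \<open>The denominator of \<open>boost\<close> vanishes only at height 5/4 in absolute value,
  so this slab is an open neighbourhood of the sphere on which the caps are rational.\<close>

lemma open_boost_domain: "open {x::real^3. \<bar>x $ 3\<bar> < 5/4}"
  by (intro open_Collect_less continuous_intros)

lemma hemi_boost_domain: "hemi \<sigma> \<subseteq> {x. \<bar>x $ 3\<bar> < 5/4}"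
  using S2_nth_le_1[of _ 3] by (fastforce simp: hemi_def)

lemma boost_ratfun:
  assumes "\<sigma>^2 = 1"
  shows "ratfun {x. \<bar>x $ 3\<bar> < 5/4} (\<lambda>x. boost \<sigma> x $ i)"
proof -
  have "\<forall>i. ratfun {x. \<bar>x $ 3\<bar> < 5/4} (\<lambda>x. boost \<sigma> x $ i)"
    unfolding forall_3 boost_nth
    by (intro conjI ratfun_intros) (use boost_denom_pos[OF assms] in fastforce)+
  then show ?thesis by simp
qed

lemma cap_ratfun:
  assumes "\<sigma>^2 = 1"
  shows "ratfun {x. \<bar>x $ 3\<bar> < 5/4} (\<lambda>x. cap \<sigma> x $ i)"
  unfolding CH_def vector_add_component vector_scaleR_component real_scaleR_def
  by (intro ratfun_intros boost_ratfun[OF assms])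

text \<open>The smooth extension beyond the equator is \<open>cap\<close> with the same sign, which
  in general differs from \<open>surf\<close> there.\<close>

lemma surf_Ck_hemi:
  assumes "\<sigma>^2 = 1"
  shows "Ck_set k (hemi \<sigma>) surf"
  unfolding Ck_set_def
  by (rule exI[of _ "{x. \<bar>x $ 3\<bar> < 5/4}"], rule exI[of _ "\<lambda>x. cap \<sigma> x"],
      intro conjI ballI open_boost_domain hemi_boost_domain ratfun_Ck_vec cap_ratfun assms)
    (simp add: surf_hemi[OF assms])

lemma boost_Ck_hemi:
  assumes "\<sigma>^2 = 1"
  shows "Ck_set k (hemi \<sigma>) (boost \<sigma>)"
  unfolding Ck_set_def
  by (rule exI[of _ "{x. \<bar>x $ 3\<bar> < 5/4}"], rule exI[of _ "boost \<sigma>"],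
      intro conjI ballI open_boost_domain hemi_boost_domain ratfun_Ck_vec boost_ratfun assms refl)

lemma S2_eq_hemi: "S2 = hemi 1 \<union> hemi (-1)"
  by (auto simp: hemi_def)

lemma surf_continuous: "continuous_on S2 surf"
  unfolding S2_eq_hemi
proof (intro continuous_on_closed_Un compact_imp_closed compact_hemi)
  have "continuous_on (hemi \<sigma>) surf" if s: "\<sigma>^2 = 1" for \<sigma>
  proof -
    obtain U F where "hemi \<sigma> \<subseteq> U" "Ck_vec 0 U F" and eq: "\<And>x. x \<in> hemi \<sigma> \<Longrightarrow> F x = surf x"
      using surf_Ck_hemi[OF s, of 0] unfolding Ck_set_def by blast
    then have "continuous_on (hemi \<sigma>) F"
      unfolding Ck_vec_def Ck_on.simps by (metis continuous_on_componentwise continuous_on_subset)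
    then show ?thesis using eq continuous_on_cong by metis
  qed
  then show "continuous_on (hemi 1) surf" "continuous_on (hemi (-1)) surf" by auto
qed

lemma surf_sdiff:
  assumes "\<sigma>^2 = 1" "p \<in> intS (hemi \<sigma>)" "v \<in> tang p"
  shows "sdiff surf p v = dcap \<sigma> p v"
    "sdiff (\<lambda>q. cahn_hoffman gam (boost \<sigma> q)) p v = dcap \<sigma> p v"
  using surf_scurve_deriv[OF assms(1) _ _ assms(3)] cahn_hoffman_scurve_deriv[OF assms(1) _ assms(3)]
    assms(2) unfolding intS_hemi[OF assms(1)] sdiff_def
  by (auto intro: vector_derivative_at)

lemma surf_immersion:
  assumes s: "\<sigma>^2 = 1" and p: "p \<in> intS (hemi \<sigma>)" and v: "v \<in> tang p" "v \<noteq> 0"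
  shows "dcap \<sigma> p v \<noteq> 0"
proof
  assume 0: "dcap \<sigma> p v = 0"
  have ph: "p \<in> hemi \<sigma>" using p by (simp add: intS_def)
  obtain \<kappa> where k: "\<kappa> > 0" "\<And>v w. v \<in> tang p \<Longrightarrow> w \<in> tang p \<Longrightarrow>
     cross3 (dcap \<sigma> p v) (dcap \<sigma> p w) \<bullet> boost \<sigma> p = \<kappa> * (cross3 v w \<bullet> p)"
    using dcap_orientation[OF s ph] by blast
  \<comment> \<open>The rotated vector p x v completes v to a positive basis of the tangent plane,
    so a vanishing image of v would contradict the positive Jacobian.\<close>
  have w: "cross3 p v \<in> tang p"
    by (simp add: tang_def dot_cross_self)
  have "cross3 v (cross3 p v) \<bullet> p = (v \<bullet> v) * (p \<bullet> p)"
    using v(1) by (simp add: Lagrange tang_def inner_diff_left)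
  also have "\<dots> > 0" using v(2) ph by (simp add: hemi_def S2_inner)
  finally show False using k(1) k(2)[OF v(1) w] 0 by simp
qed

text \<open>Since the field and the surface have equal differentials, the numerator is -2 N . N, and
  the quotient is -1 once N is known to be nonzero.\<close>

lemma surf_anis_mc:
  assumes s: "\<sigma>^2 = 1" and p: "p \<in> intS (hemi \<sigma>)"
    and e: "v \<in> tang p" "w \<in> tang p" "cross3 v w \<noteq> 0"
  shows "anis_mc gam surf (boost \<sigma>) p v w = -1"
proof -
  have ph: "p \<in> hemi \<sigma>" using p by (simp add: intS_def)
  obtain \<kappa> where k: "\<kappa> > 0" "\<And>v w. v \<in> tang p \<Longrightarrow> w \<in> tang p \<Longrightarrow>
     cross3 (dcap \<sigma> p v) (dcap \<sigma> p w) \<bullet> boost \<sigma> p = \<kappa> * (cross3 v w \<bullet> p)"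
    using dcap_orientation[OF s ph] by blast
  have "cross3 v w = (cross3 v w \<bullet> p) *\<^sub>R p"
    using cross3_orthogonal_to_unit[of v p w] e ph by (simp add: tang_def hemi_def S2_norm)
  then have "cross3 v w \<bullet> p \<noteq> 0" using e(3) by (metis scaleR_zero_left)
  then have "cross3 (dcap \<sigma> p v) (dcap \<sigma> p w) \<noteq> 0"
    using k(1) k(2)[OF e(1,2)] by auto
  then show ?thesis
    unfolding anis_mc_def Let_def surf_sdiff[OF s p e(1)] surf_sdiff[OF s p e(2)]
      inner_add_left power2_norm_eq_inner by simp
qed

definition side :: "nat \<Rightarrow> real" where
  "side i = (if i = 0 then 1 else -1)"

lemma side_sq: "(side i)^2 = 1"
  by (simp add: side_def)

lemma surf_pw_weak_immersion:
  "pw_weak_immersion 2 (\<lambda>i. hemi (side i)) surf (\<lambda>i. boost (side i))"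
  unfolding pw_weak_immersion_def
proof (intro conjI allI impI ballI)
  show "(\<Union>i<2. hemi (side i)) = S2"
    by (auto simp: S2_eq_hemi side_def lessThan_Suc numeral_2_eq_2)
  fix i j :: nat assume "i < 2" "j < 2" "i \<noteq> j"
  then show "hemi (side i) \<inter> hemi (side j) = bdS (hemi (side i)) \<inter> bdS (hemi (side j))"
    unfolding bdS_hemi[OF side_sq] by (auto simp: hemi_def side_def split: if_splits)
next
  fix i :: nat
  show "regular_domain (hemi (side i))" "Ck_set 2 (hemi (side i)) surf"
    "Ck_set 1 (hemi (side i)) (boost (side i))"
    by (intro regular_domain_hemi surf_Ck_hemi boost_Ck_hemi side_sq)+
  show "boost (side i) ` hemi (side i) \<subseteq> S2"
    using boost_S2[OF side_sq] by (auto simp: hemi_def)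
  fix p assume p: "p \<in> intS (hemi (side i))"
  then have ph: "p \<in> hemi (side i)" and pS: "p \<in> S2" by (auto simp: intS_def hemi_def)
  fix v assume v: "v \<in> tang p"
  note sd = surf_sdiff(1)[OF side_sq p]
  show "sdiff surf p v \<noteq> 0" if "v \<noteq> 0"
    using surf_immersion[OF side_sq p v that] by (simp add: sd v)
  have "v \<bullet> p = 0" using v by (simp add: tang_def)
  then show "boost (side i) p \<bullet> sdiff surf p v = 0"
    using dCH_normal[OF boost_S2[OF side_sq pS] dboost_normal[OF side_sq pS]]
    by (simp add: sd v inner_commute)
  fix w assume w: "w \<in> tang p" and "cross3 v w \<bullet> p > 0"
  moreover obtain \<kappa> where "\<kappa> > 0" "\<And>v w. v \<in> tang p \<Longrightarrow> w \<in> tang p \<Longrightarrow>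
     cross3 (dcap (side i) p v) (dcap (side i) p w) \<bullet> boost (side i) p = \<kappa> * (cross3 v w \<bullet> p)"
    using dcap_orientation[OF side_sq ph] by blast
  ultimately show "cross3 (sdiff surf p v) (sdiff surf p w) \<bullet> boost (side i) p > 0"
    by (simp add: sd v)
qed (auto simp: surf_continuous)

lemma surf_CAMC: "CAMC gam 2 (\<lambda>i. hemi (side i)) surf (\<lambda>i. boost (side i))"
  unfolding CAMC_def
proof (intro conjI allI impI ballI exI[of _ "-1"] surf_pw_weak_immersion)
  fix i :: nat and p assume p: "p \<in> intS (hemi (side i))"
  then have pS: "p \<in> S2" by (auto simp: intS_def hemi_def)
  show "sdiffable (\<lambda>q. cahn_hoffman gam (boost (side i) q)) p"
    using cahn_hoffman_scurve_deriv[OF side_sq pS]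
    unfolding sdiffable_def by (blast intro: differentiableI_vector)
  fix e1 e2 assume "e1 \<in> tang p" "e2 \<in> tang p" "cross3 e1 e2 \<noteq> 0"
  then show "anis_mc gam surf (boost (side i)) p e1 e2 = -1"
    using surf_anis_mc[OF side_sq p] by blast
next
  fix i j :: nat and \<zeta> assume "\<zeta> \<in> bdS (hemi (side i)) \<inter> bdS (hemi (side j))"
  then have z: "\<zeta> \<in> S2" "\<zeta> $ 3 = 0" by (auto simp: bdS_hemi[OF side_sq])
  \<comment> \<open>Both caps give the same point of the edge, so the field has jump 0, which lies
    in every span.\<close>
  have "cap (side i) \<zeta> = cap (side j) \<zeta>"
    using cap_equator[OF side_sq z(2), of i] cap_equator[OF side_sq z(2), of j]
    by (simp add: vec_eq_iff forall_3)
  then have "cahn_hoffman gam (boost (side i) \<zeta>) - cahn_hoffman gam (boost (side j) \<zeta>) = 0"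
    using z by (simp add: cahn_hoffman_gam boost_S2[OF side_sq])
  then show "cahn_hoffman gam (boost (side i) \<zeta>) - cahn_hoffman gam (boost (side j) \<zeta>)
       \<in> tspace (surf ` (bdS (hemi (side i)) \<inter> bdS (hemi (side j)))) (surf \<zeta>)"
    by (simp add: tspace_def span_zero)
qed

section \<open>The integrand is not convex, and the surface is not a Wulff shape\<close>

lemma gam_smooth: "Cinf_set S2 gam"
proof -
  have "ratfun UNIV gam"
    unfolding gam_def by (intro ratfun_intros)
  then have "Cinf_vec UNIV gam"
    by (auto simp: Cinf_vec_def Ck_vec_def intro: ratfun_Ck_on)
  then show ?thesis unfolding Cinf_set_def by (intro exI[of _ UNIV] exI[of _ gam]) auto
qed

text \<open>The minimum 70 - 27 - 25 is taken at the poles. It gives positivity of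
  \<open>gam\<close> and also locates the poles of the Wulff shape.\<close>

lemma gam_ge_18:
  assumes "\<nu> \<in> S2"
  shows "18 \<le> gam \<nu>"
proof -
  have "(\<nu> $ 3)^2 \<le> 1" using S2_nth_le_1[OF assms] by (simp add: abs_square_le_1)
  moreover from this have "(\<nu> $ 3)^4 \<le> 1"
    using power_mono[of "(\<nu> $ 3)^2" 1 2] by simp
  ultimately show ?thesis by (simp add: gam_def)
qed

text \<open>Supplying the norm N as a rational number avoids square roots at the Pythagorean points
  used for non-convexity.\<close>

lemma homext_gam_vector:
  assumes "0 < N" "N^2 = x^2 + y^2 + z^2"
  shows "homext gam (vector [x, y, z]) = N * (70 - 27 * (z / N)^2 - 25 * (z / N)^4)"
proof -
  have "norm (vector [x, y, z] :: real^3) = sqrt (N^2)"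
    unfolding assms(2) by (simp add: norm_eq_sqrt_inner inner_vec_def sum_3 power2_eq_square)
  then have "norm (vector [x, y, z] :: real^3) = N" using assms(1) by simp
  then show ?thesis by (simp add: homext_def gam_def divide_inverse mult.commute)
qed

lemma gam_not_convex: "\<not> convex_integrand gam"
proof
  assume "convex_integrand gam"
  then have c: "convex_on UNIV (homext gam)" by (simp add: convex_integrand_def)
  \<comment> \<open>These two points and the point (1, 0, 3/4) between them have norms 1, 5/3 and
    5/4. The extension takes the values 70, 70.8 and 71.3 there, while convexity would allow at most
    70.45 at the middle point.\<close>
  define x y :: "real^3" where "x = vector [1, 0, 0]" and "y = vector [1, 0, 4/3]"
  have xy: "(1 - 9/16) *\<^sub>R x + (9/16) *\<^sub>R y = (vector [1, 0, 3/4] :: real^3)"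
    by (simp add: x_def y_def vec_eq_iff forall_3)
  have "homext gam ((1 - 9/16) *\<^sub>R x + (9/16) *\<^sub>R y)
      \<le> (1 - 9/16) * homext gam x + (9/16) * homext gam y"
    by (rule convex_onD[OF c]) auto
  then show False
    unfolding xy unfolding x_def y_def
    using homext_gam_vector[of 1 1 0 0] homext_gam_vector[of "5/3" 1 0 "4/3"]
      homext_gam_vector[of "5/4" 1 0 "3/4"]
    by (simp add: power2_eq_square power4_eq_xxxx)
qed

section \<open>Comparing the extents of the Wulff shape and the surface\<close>

lemma Wulff_subset: "Wulff g \<subseteq> (\<Inter>\<nu>\<in>S2. {x. x \<bullet> \<nu> \<le> g \<nu>})"
  unfolding Wulff_def
  by (intro frontier_subset_closed closed_INT ballI closed_Collect_le continuous_intros)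

text \<open>All constraints hold because \<open>gam\<close> is at least 18, and the constraint in
  the direction of the pole is tight, so the point is not interior.\<close>

lemma Wulff_pole:
  assumes t: "\<bar>t\<bar> = 18"
  shows "t *\<^sub>R e3 \<in> Wulff gam"
proof -
  let ?K = "\<Inter>\<nu>\<in>S2. {x. x \<bullet> \<nu> \<le> gam \<nu>}"
  have "t * \<nu> $ 3 \<le> 18" if "\<nu> \<in> S2" for \<nu>
    using S2_nth_le_1[OF that, of 3] t abs_le_D1[of "t * \<nu> $ 3" 18] by (simp add: abs_mult)
  then have "t *\<^sub>R e3 \<in> ?K"
    using gam_ge_18 by (force simp: inner_axis')
  moreover have "t *\<^sub>R e3 \<notin> interior ?K"
  proof
    assume "t *\<^sub>R e3 \<in> interior ?K"
    then obtain r where r: "r > 0" "ball (t *\<^sub>R e3) r \<subseteq> ?K" by (auto simp: mem_interior)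
    define s where "s = t / 18"
    have "t = 18 \<or> t = -18" using t by arith
    then have s: "s^2 = 1" by (auto simp: s_def)
    \<comment> \<open>A step of r/2 outwards stays in the ball but violates the constraint for the
      normal s e3.\<close>
    have "(t + s * (r/2)) *\<^sub>R e3 \<in> ball (t *\<^sub>R e3) r"
      using r(1) t by (simp add: dist_norm s_def abs_mult flip: scaleR_diff_left)
    then have K: "(t + s * (r/2)) *\<^sub>R e3 \<in> ?K" using r(2) by blast
    have "s *\<^sub>R e3 \<in> S2" using s by (simp add: S2_iff axis_def)
    moreover have "gam (s *\<^sub>R e3) = 18"
      using s power_mult[of s 2 2] by (simp add: gam_def axis_def)
    ultimately have "(t + s * (r/2)) * s \<le> 18" using K by (auto simp: inner_axis_axis)
    moreover have "(t + s * (r/2)) * s = s^2 * (18 + r/2)"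
      by (simp add: s_def algebra_simps power2_eq_square)
    ultimately show False using s r(1) by simp
  qed
  ultimately show ?thesis unfolding Wulff_def frontier_def using closure_subset by blast
qed

lemma surf_height:
  assumes "p \<in> S2"
  shows "\<bar>surf p $ 3\<bar> \<le> 18"
proof -
  obtain \<sigma> where s: "\<sigma>^2 = 1" "p \<in> hemi \<sigma>" using S2_hemi_cases[OF assms] .
  show ?thesis
    using hemi_height_nonneg(1,2)[OF s] sign_cases[OF s(1)] by auto
qed

lemma surf_not_Wulff:
  assumes a: "a > 0"
  shows "surf ` S2 \<noteq> (\<lambda>x. a *\<^sub>R x + b) ` Wulff gam"
proof
  assume eq: "surf ` S2 = (\<lambda>x. a *\<^sub>R x + b) ` Wulff gam"
  have "\<bar>(a *\<^sub>R (t *\<^sub>R e3) + b) $ 3\<bar> \<le> 18" if t: "\<bar>t\<bar> = 18" for t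
  proof -
    obtain p where "p \<in> S2" "a *\<^sub>R (t *\<^sub>R e3) + b = surf p"
      using imageI[OF Wulff_pole[OF t], of "\<lambda>x. a *\<^sub>R x + b"] unfolding eq[symmetric] by blast
    then show ?thesis using surf_height by metis
  qed
  \<comment> \<open>The two poles are 36 a apart after scaling, inside a slab of thickness 36; the
    translation cancels.\<close>
  from this[of 18] this[of "-18"] have a1: "a \<le> 1" by (simp add: abs_le_iff)
  \<comment> \<open>The horizontal extent is tested at the equatorial points with first coordinate 1
    and -1. In the difference of the two equations the translation cancels again, leaving 141.6 = a
    (x - y), although a is at most 1 and x - y at most 140.\<close>
  have "\<bar>t\<bar> = 1 \<Longrightarrow> \<exists>x. x * t \<le> 70 \<and> 354/5 * t = a * x + b $ 1" for t :: real
  proof -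
    assume t: "\<bar>t\<bar> = 1"
    have tS: "t *\<^sub>R axis 1 1 \<in> S2" using t by (simp add: S2_norm)
    then obtain x where x: "x \<in> Wulff gam" "surf (t *\<^sub>R axis 1 1) = a *\<^sub>R x + b"
      using eq by (metis (no_types, lifting) imageE imageI)
    have "x \<bullet> (t *\<^sub>R axis 1 1) \<le> gam (t *\<^sub>R axis 1 1)"
      using x(1) tS Wulff_subset by blast
    moreover have "gam (t *\<^sub>R axis 1 1) = 70" by (simp add: gam_def axis_def)
    ultimately have "x $ 1 * t \<le> 70" by (simp add: inner_axis mult.commute)
    moreover have "surf (t *\<^sub>R axis 1 1) $ 1 = 354/5 * t"
      using cap_equator(1)[of 1 "t *\<^sub>R axis 1 1"] by (simp add: surf_def axis_def)
    ultimately show ?thesis using x(2) by auto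
  qed
  note this[of 1] this[of "-1"]
  then obtain x y where
    "x \<le> 70" "- y \<le> 70" "354/5 = a * x + b $ 1" "- (354/5) = a * y + b $ 1" by auto
  then have "708/5 = a * (x - y)" "x - y \<le> 140" by (auto simp: algebra_simps)
  moreover from this have "a * (x - y) \<le> 1 * 140"
    using a a1 by (intro mult_mono) (auto, smt (verit) mult_pos_neg)
  ultimately show False by simp
qed

theorem theorem1p2:
  shows "\<exists>g::real^3 \<Rightarrow> real. Cinf_set S2 g \<and> (\<forall>\<nu>\<in>S2. g \<nu> > 0) \<and> \<not> convex_integrand g \<and>
     (\<exists>k M X \<nu>. CAMC g k M X \<nu> \<and> inj_on X S2 \<and>
        (\<forall>a::real. a > 0 \<longrightarrow> (\<forall>b. X ` S2 \<noteq> (\<lambda>x. a *\<^sub>R x + b) ` Wulff g)))"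
proof (intro exI conjI ballI allI impI)
  show "Cinf_set S2 gam" by (rule gam_smooth)
  show "gam \<nu> > 0" if "\<nu> \<in> S2" for \<nu> using gam_ge_18[OF that] by simp
  show "\<not> convex_integrand gam" by (rule gam_not_convex)
  show "CAMC gam 2 (\<lambda>i. hemi (side i)) surf (\<lambda>i. boost (side i))" by (rule surf_CAMC)
  show "inj_on surf S2" by (rule surf_inj)
  show "surf ` S2 \<noteq> (\<lambda>x. a *\<^sub>R x + b) ` Wulff gam" if "a > 0" for a b
    using surf_not_Wulff[OF that] .
qed

end
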